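(* Let $\alpha>0$ and $\beta,\gamma,\delta\ge 0$ be real numbers, let $\lambda\in\mathbb{R}$, let $t>0$, let $k\ge 0$ be an integer, let $$G=\begin{bmatrix}0&1\\ -\alpha\lambda-\delta&-\beta\lambda-\gamma\end{bmatrix},$$ and denote $m=-\tfrac12(\beta\lambda+\gamma)$. (i) If $(\beta\lambda+\gamma)^2>4(\alpha\lambda+\delta)$, then with $n=\tfrac12\sqrt{(\beta\lambda+\gamma)^2-4(\alpha\lambda+\delta)}$, $$\varphi_k(tG)=\frac{\varphi_k^+-\varphi_k^-}{2n}\begin{bmatrix}-m-n&1\\ n^2-m^2&m-n\end{bmatrix}+\varphi_k^+I,$$ where $\varphi_k^+=\varphi_k(t(m+n))$ and $\varphi_k^-=\varphi_k(t(m-n))$. (ii) If $(\beta\lambda+\gamma)^2=4(\alpha\lambda+\delta)$, then $$\varphi_k(tG)=\varphi_k'(tm)\begin{bmatrix}-tm&t\\ -tm^2&tm\end{bmatrix}+\varphi_k(tm)I,$$ where the derivatives $\varphi_k'$ satisfy the recursion $\varphi_0(z)=\varphi_0'(z)=\mathrm{e}^z$ and, for all integers $j\ge0$ and all $z\ne0$, $$\varphi_{j+1}'(z)=\frac{\varphi_j'(z)-\varphi_{j+1}(z)}{z},\qquad \varphi_{j+1}(z)=\frac{\varphi_j(z)-\varphi_j(0)}{z}.$$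
   Context: $I$ denotes the $2\times2$ identity matrix. The entire functions $\varphi_k$ are $\varphi_0(z)=\mathrm{e}^z$ and, for $k\ge1$, $$\varphi_k(z)=\int_0^1\mathrm{e}^{(1-\theta)z}\frac{\theta^{k-1}}{(k-1)!}\,d\theta;$$ equivalently $\varphi_k(z)=\sum_{j=0}^\infty\frac{z^j}{(j+k)!}$ for all $k\ge0$. For a square matrix $M$, $\varphi_k(M)=\sum_{j=0}^\infty\frac{M^j}{(j+k)!}$. $\varphi_k'$ denotes the derivative of the scalar function $\varphi_k$. *)

theory Defs
  imports "HOL-Analysis.Analysis"
begin

definition phi :: "nat \<Rightarrow> complex \<Rightarrow> complex" where
  "phi k z =
     (if k = 0 then exp z
      else integral {0..1} (\<lambda>\<theta>::real. exp ((1 - of_real \<theta>) * z) * (of_real \<theta> ^ (k - 1) / fact (k - 1))))"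

definition mscale :: "'a::times \<Rightarrow> 'a ^ 'm ^ 'n \<Rightarrow> 'a ^ 'm ^ 'n" (infixr "*\<^sub>M" 75) where
  "c *\<^sub>M A = map_matrix ((*) c) A"

(* The operations * and ^ on vectors are componentwise, hence the explicit iteration of **. *)
definition mpow :: "'a::semiring_1 ^ 'n ^ 'n \<Rightarrow> nat \<Rightarrow> 'a ^ 'n ^ 'n" where
  "mpow A j = (((**) A) ^^ j) (mat 1)"

definition phi_mat :: "nat \<Rightarrow> complex ^ 'n ^ 'n \<Rightarrow> complex ^ 'n ^ 'n" where
  "phi_mat k A = (\<Sum>j. (1 / fact (j + k)) *\<^sub>M mpow A j)"

end

theory Submission
  imports Defs
begin

text \<open>
  If \<open>M = N + a I\<close> with \<open>M N = b N\<close>, then \<open>M\<^sup>j = p\<^sub>j N + a\<^sup>j I\<close>, where \<open>p\<^sub>j\<close> is the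
  divided difference of \<open>z\<^sup>j\<close> at \<open>a, b\<close>. Summing against \<open>1 / (j + k)!\<close> turns \<open>p\<^sub>j\<close> into
  the divided difference of \<open>\<phi>\<^sub>k\<close>, that is, into \<open>\<phi>\<^sub>k'(a)\<close> when \<open>a = b\<close>. Here \<open>a, b\<close> are
  the eigenvalues of \<open>t G\<close>, and \<open>M N = b N\<close> is the Cayley--Hamilton identity.
\<close>

section \<open>Scalar functions: recursion, power series, derivatives\<close>

lemma phi_Suc_mult: "z * phi (Suc k) z = phi k z - 1 / fact k"
proof (cases k)
  case 0
  define f where "f = (\<lambda>\<theta>::real. exp ((1 - of_real \<theta>) * z))"
  \<comment> \<open>\<open>phi 0\<close> is not given by an integral, hence the separate case. Here
    the integrand is its own antiderivative up to the factor \<open>- z\<close>.\<close>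
  have "((\<lambda>\<theta>. - z * f \<theta>) has_integral (f 1 - f 0)) {0..1}"
    unfolding f_def
    by (rule fundamental_theorem_of_calculus)
      (auto intro!: derivative_eq_intros has_vector_derivative_real_field)
  from integral_unique[OF this] have "z * integral {0..1} f = f 0 - f 1"
    by (simp add: minus_equation_iff[of "z * _"])
  with 0 show ?thesis by (simp add: phi_def f_def)
next
  case (Suc l)
  define e where "e = (\<lambda>\<theta>::real. exp ((1 - of_real \<theta>) * z))"
  define f where "f = (\<lambda>\<theta>::real. e \<theta> * (of_real \<theta> ^ k / fact k))"
  define g where "g = (\<lambda>\<theta>::real. e \<theta> * (of_real \<theta> ^ l / fact l))"
  have int: "(\<lambda>\<theta>. - z * f \<theta>) integrable_on {0..1}" "g integrable_on {0..1}"
    unfolding f_def g_def e_def by (auto intro!: integrable_continuous_interval continuous_intros)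
  \<comment> \<open>Integration by parts: \<open>f\<close> and \<open>g\<close> are the integrands
    of \<open>phi (Suc k)\<close> and \<open>phi k\<close>, and the product rule gives f' = - z f +
    g. The boundary values are \<open>f 1 = 1 / fact k\<close> and \<open>f 0 = 0\<close>, the
    latter because k > 0.\<close>
  have "((\<lambda>\<theta>. - z * f \<theta> + g \<theta>) has_integral (f 1 - f 0)) {0..1}"
  proof (rule fundamental_theorem_of_calculus)
    fix x :: real
    have e: "((\<lambda>w. exp ((1 - w) * z)) has_field_derivative (- z * e x)) (at (of_real x))"
      unfolding e_def by (auto intro!: derivative_eq_intros)
    have p: "((\<lambda>w. w ^ k / fact k) has_field_derivative (of_real x ^ l / fact l :: complex)) (at (of_real x))"
      using DERIV_cdivide[OF DERIV_power[OF DERIV_ident, of k], where c = "fact k"] Suc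
      by (simp del: of_nat_Suc)
    have "((\<lambda>w. exp ((1 - w) * z) * (w ^ k / fact k)) has_field_derivative (- z * f x + g x)) (at (of_real x))"
      using DERIV_mult[OF e p] by (simp add: f_def g_def e_def algebra_simps)
    then show "(f has_vector_derivative - z * f x + g x) (at x within {0..1})"
      unfolding f_def e_def by (rule has_vector_derivative_real_field)
  qed simp
  from integral_unique[OF this] have "- z * integral {0..1} f + integral {0..1} g = f 1 - f 0"
    unfolding integral_add[OF int] by simp
  then show ?thesis
    using Suc by (simp add: phi_def f_def g_def e_def algebra_simps)
qed

lemma phi_zero: "phi k 0 = 1 / fact k"
  using phi_Suc_mult[of 0 k] by simp

lemma summable_exp_shift: "summable (\<lambda>j. 1 / fact (j + k) * z ^ j :: complex)"
proof (rule summable_comparison_test')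
  show "summable (\<lambda>j. norm z ^ j / fact j)"
    using summable_exp[of "norm z"] by (simp add: field_simps)
  fix j :: nat
  have "(fact j :: real) \<le> fact (j + k)" by (rule fact_mono) simp
  then show "norm (1 / fact (j + k) * z ^ j :: complex) \<le> norm z ^ j / fact j"
    by (simp add: norm_mult norm_divide norm_power frac_le)
qed

text \<open>Links the integral definition to the series behind \<open>phi_mat\<close>. Dropping the
  constant term of the series of \<open>phi k\<close> and dividing by z gives that of
  \<open>phi (Suc k)\<close>; the division forces z = 0 to be treated apart.\<close>

lemma phi_sums: "(\<lambda>j. 1 / fact (j + k) * z ^ j) sums phi k z"
proof (cases "z = 0")
  case True
  have "(\<lambda>j. 1 / fact (j + k) * 0 ^ j) sums (1 / fact (0 + k) :: complex)"
    using powser_sums_zero[of "\<lambda>j. 1 / fact (j + k) :: complex"] by simp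
  then show ?thesis using True by (simp add: phi_zero)
next
  case False
  then show ?thesis
  proof (induction k)
    case 0
    then show ?case using exp_converges[of z] by (simp add: phi_def scaleR_conv_of_real divide_inverse)
  next
    case (Suc k)
    then have "(\<lambda>j. 1 / fact (Suc j + k) * z ^ Suc j) sums (z * phi (Suc k) z)"
      by (subst sums_Suc_iff) (simp add: phi_Suc_mult)
    from sums_divide[OF this, of z] Suc.prems show ?case by (simp add: mult.assoc)
  qed
qed

lemma phi_has_field_derivative:
  obtains D where "(phi k has_field_derivative D) (at z)"
    and "(\<lambda>j. of_nat j * (1 / fact (j + k)) * z ^ (j - 1)) sums D"
proof
  let ?c = "\<lambda>j. 1 / fact (j + k) :: complex"
  have eq: "phi k = (\<lambda>w. \<Sum>j. ?c j * w ^ j)"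
    using phi_sums by (simp add: sums_iff fun_eq_iff)
  show "(phi k has_field_derivative (\<Sum>j. diffs ?c j * z ^ j)) (at z)"
    unfolding eq by (rule termdiffs_strong_converges_everywhere) (rule summable_exp_shift)
  have "summable (\<lambda>j. diffs ?c j * z ^ j)"
    by (rule termdiff_converges_all) (rule summable_exp_shift)
  \<comment> \<open>Shifts the index so that the series runs over the original coefficients; the
    truncated exponent at j = 0 is harmless, as its factor is 0.\<close>
  from diffs_equiv[OF this]
  show "(\<lambda>j. of_nat j * (1 / fact (j + k)) * z ^ (j - 1)) sums (\<Sum>j. diffs ?c j * z ^ j)" by simp
qed

lemma phi_deriv: "(phi k has_field_derivative deriv (phi k) z) (at z)"
  by (metis phi_has_field_derivative DERIV_imp_deriv)

lemma deriv_phi_sums: "(\<lambda>j. of_nat j * (1 / fact (j + k)) * z ^ (j - 1)) sums deriv (phi k) z"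
  by (metis phi_has_field_derivative DERIV_imp_deriv)

text \<open>Obtained by differentiating both sides of \<open>phi_Suc_mult\<close>; the constant
  \<open>1 / fact k\<close> drops out.\<close>

lemma deriv_phi_Suc_mult: "z * deriv (phi (Suc k)) z = deriv (phi k) z - phi (Suc k) z"
proof -
  have "((\<lambda>w. w * phi (Suc k) w) has_field_derivative
      (1 * phi (Suc k) z + deriv (phi (Suc k)) z * z)) (at z)"
    by (intro DERIV_mult DERIV_ident phi_deriv)
  moreover have "((\<lambda>w. w * phi (Suc k) w) has_field_derivative deriv (phi k) z - 0) (at z)"
    unfolding phi_Suc_mult by (intro DERIV_diff DERIV_const phi_deriv)
  ultimately show ?thesis
    using DERIV_unique by (fastforce simp: algebra_simps)
qed

section \<open>Powers and series of matrices of the form N + a I\<close>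

lemma mscale_nth [simp]: "(c *\<^sub>M A) $ i $ j = c * A $ i $ j"
  by (simp add: mscale_def map_matrix_def)

lemma mscale_sums:
  fixes A :: "complex ^ 'm ^ 'n"
  assumes "f sums s"
  shows "(\<lambda>j. f j *\<^sub>M A) sums (s *\<^sub>M A)"
proof -
  \<comment> \<open>A linear map on a finite-dimensional space is bounded, so it commutes with
    infinite sums.\<close>
  have "linear (\<lambda>c. c *\<^sub>M A)"
    by (rule linearI) (simp_all add: vec_eq_iff algebra_simps)
  then have "bounded_linear (\<lambda>c. c *\<^sub>M A)"
    by (simp add: linear_conv_bounded_linear)
  then show ?thesis using assms by (rule bounded_linear.sums)
qed

text \<open>The coefficients \<open>p\<close> enter only through their recurrence, so that distinct
  and equal eigenvalues share one induction.\<close>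

lemma mpow_add_mscale_mat:
  fixes N :: "complex ^ 'n ^ 'n"
  assumes "(N + a *\<^sub>M mat 1) ** N = b *\<^sub>M N"
    and "p 0 = 0" and "\<And>j. p (Suc j) = b * p j + a ^ j"
  shows "mpow (N + a *\<^sub>M mat 1) j = p j *\<^sub>M N + a ^ j *\<^sub>M mat 1"
proof (induction j)
  case 0
  then show ?case by (simp add: mpow_def vec_eq_iff assms(2))
next
  case (Suc j)
  let ?M = "N + a *\<^sub>M mat 1"
  have scale: "A ** (c *\<^sub>M B) = c *\<^sub>M (A ** B)" for A B :: "complex ^ 'n ^ 'n" and c
    by (simp add: vec_eq_iff matrix_matrix_mult_def sum_distrib_left algebra_simps)
  have "mpow ?M (Suc j) = ?M ** (p j *\<^sub>M N + a ^ j *\<^sub>M mat 1)"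
    using Suc by (simp add: mpow_def)
  also have "\<dots> = p j *\<^sub>M (b *\<^sub>M N) + a ^ j *\<^sub>M ?M"
    by (simp only: matrix_add_ldistrib scale assms(1) matrix_mul_rid)
  also have "\<dots> = p (Suc j) *\<^sub>M N + a ^ Suc j *\<^sub>M mat 1"
    by (simp add: vec_eq_iff assms(3) algebra_simps)
  finally show ?case .
qed

text \<open>The coefficients of \<open>N\<close> and of the identity are summed separately. The
  value \<open>s\<close> stays open, to be identified once \<open>p\<close> is explicit.\<close>

lemma phi_mat_add_mscale_mat:
  fixes N :: "complex ^ 'n ^ 'n"
  assumes "(N + a *\<^sub>M mat 1) ** N = b *\<^sub>M N"
    and "p 0 = 0" and "\<And>j. p (Suc j) = b * p j + a ^ j"
    and "(\<lambda>j. 1 / fact (j + k) * p j) sums s"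
  shows "phi_mat k (N + a *\<^sub>M mat 1) = s *\<^sub>M N + phi k a *\<^sub>M mat 1"
proof -
  have "(\<lambda>j. (1 / fact (j + k) * p j) *\<^sub>M N + (1 / fact (j + k) * a ^ j) *\<^sub>M mat 1) sums
      (s *\<^sub>M N + phi k a *\<^sub>M mat 1)"
    by (intro sums_add mscale_sums assms phi_sums)
  moreover have "(1 / fact (j + k)) *\<^sub>M mpow (N + a *\<^sub>M mat 1) j =
      (1 / fact (j + k) * p j) *\<^sub>M N + (1 / fact (j + k) * a ^ j) *\<^sub>M mat 1" for j
    unfolding mpow_add_mscale_mat[where p = p, OF assms(1-3)]
    by (simp add: vec_eq_iff algebra_simps)
  ultimately show ?thesis by (simp add: phi_mat_def sums_iff)
qed

lemma phi_mat_distinct: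
  fixes N :: "complex ^ 'n ^ 'n"
  assumes "(N + a *\<^sub>M mat 1) ** N = b *\<^sub>M N" and "a \<noteq> b"
  shows "phi_mat k (N + a *\<^sub>M mat 1) =
    ((phi k a - phi k b) / (a - b)) *\<^sub>M N + phi k a *\<^sub>M mat 1"
\<comment> \<open>For a \<noteq> b the recurrence is solved by the divided difference of the j-th
  power.\<close>
proof (rule phi_mat_add_mscale_mat[where p = "\<lambda>j. (a ^ j - b ^ j) / (a - b)", OF assms(1)])
  show "(a ^ Suc j - b ^ Suc j) / (a - b) = b * ((a ^ j - b ^ j) / (a - b)) + a ^ j" for j
    using assms(2) by (simp add: field_simps)
  show "(\<lambda>j. 1 / fact (j + k) * ((a ^ j - b ^ j) / (a - b))) sums ((phi k a - phi k b) / (a - b))"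
    using sums_divide[OF sums_diff[OF phi_sums phi_sums], where c = "a - b"]
    by (simp add: diff_divide_distrib right_diff_distrib)
qed simp

lemma phi_mat_confluent:
  fixes N :: "complex ^ 'n ^ 'n"
  assumes "(N + a *\<^sub>M mat 1) ** N = a *\<^sub>M N"
  shows "phi_mat k (N + a *\<^sub>M mat 1) = deriv (phi k) a *\<^sub>M N + phi k a *\<^sub>M mat 1"
\<comment> \<open>The limit of the divided difference as b tends to a; its weighted sum is the
  differentiated series.\<close>
proof (rule phi_mat_add_mscale_mat[where p = "\<lambda>j. of_nat j * a ^ (j - 1)", OF assms])
  show "of_nat (Suc j) * a ^ (Suc j - 1) = a * (of_nat j * a ^ (j - 1)) + a ^ j" for j
    by (cases j) (simp_all add: algebra_simps)
  show "(\<lambda>j. 1 / fact (j + k) * (of_nat j * a ^ (j - 1))) sums deriv (phi k) a"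
    using deriv_phi_sums[of k a] by (simp add: mult_ac)
qed simp

theorem lemma3p6:
  fixes \<alpha> \<beta> \<gamma> \<delta> lam t m :: real and k :: nat and G :: "complex ^ 2 ^ 2"
  assumes "\<alpha> > 0" and "\<beta> \<ge> 0" and "\<gamma> \<ge> 0" and "\<delta> \<ge> 0" and "t > 0"
    and "G = vector [vector [0, 1],
                     vector [of_real (- \<alpha> * lam - \<delta>), of_real (- \<beta> * lam - \<gamma>)]]"
    and "m = - (1 / 2) * (\<beta> * lam + \<gamma>)"
  shows
    "((\<beta> * lam + \<gamma>)\<^sup>2 > 4 * (\<alpha> * lam + \<delta>) \<longrightarrow>
       (let n = 1 / 2 * sqrt ((\<beta> * lam + \<gamma>)\<^sup>2 - 4 * (\<alpha> * lam + \<delta>));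
            phi_plus = phi k (of_real (t * (m + n)));
            phi_minus = phi k (of_real (t * (m - n)))
        in phi_mat k (of_real t *\<^sub>M G) =
             ((phi_plus - phi_minus) / of_real (2 * n)) *\<^sub>M
               vector [vector [of_real (- m - n), 1],
                       vector [of_real (n\<^sup>2 - m\<^sup>2), of_real (m - n)]]
             + phi_plus *\<^sub>M mat 1))
     \<and>
     ((\<beta> * lam + \<gamma>)\<^sup>2 = 4 * (\<alpha> * lam + \<delta>) \<longrightarrow>
        phi_mat k (of_real t *\<^sub>M G) =
          deriv (phi k) (of_real (t * m)) *\<^sub>M
            vector [vector [of_real (- t * m), of_real t],
                    vector [of_real (- t * m\<^sup>2), of_real (t * m)]]
          + phi k (of_real (t * m)) *\<^sub>M mat 1
        \<and> (\<forall>z. phi 0 z = exp z \<and> deriv (phi 0) z = exp z)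
        \<and> (\<forall>j. \<forall>z. z \<noteq> 0 \<longrightarrow>
              deriv (phi (Suc j)) z = (deriv (phi j) z - phi (Suc j) z) / z
              \<and> phi (Suc j) z = (phi j z - phi j 0) / z))"
proof (intro conjI impI)
  let ?N = "\<lambda>m n :: real. of_real t *\<^sub>M
    (vector [vector [of_real (- m - n), 1],
             vector [of_real (n\<^sup>2 - m\<^sup>2), of_real (m - n)]] :: complex ^ 2 ^ 2)"
  \<comment> \<open>G has trace 2 m, and the condition says that its determinant is (m + n) (m - n).
    So t G has eigenvalues t (m + n) and t (m - n), and \<open>?N m n\<close> is t G minus the first
    of them times I.\<close>
  have tG: "of_real t *\<^sub>M G = ?N m n + of_real (t * (m + n)) *\<^sub>M mat 1"
    if "\<alpha> * lam + \<delta> = m\<^sup>2 - n\<^sup>2" for n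
  proof -
    have "- \<alpha> * lam - \<delta> = n\<^sup>2 - m\<^sup>2" "- \<beta> * lam - \<gamma> = 2 * m"
      using that assms(7) by (simp_all add: algebra_simps)
    then show ?thesis
      unfolding assms(6) by (simp add: vec_eq_iff forall_2 vector_2 mat_def algebra_simps)
  qed
  \<comment> \<open>A polynomial identity between the entries, valid for every n; the value n = 0
    serves the double eigenvalue.\<close>
  have cayley_hamilton:
    "(?N m n + of_real (t * (m + n)) *\<^sub>M mat 1) ** ?N m n = of_real (t * (m - n)) *\<^sub>M ?N m n" for n
    by (simp add: vec_eq_iff forall_2 vector_2 mat_def matrix_matrix_mult_def sum_2
        algebra_simps power2_eq_square)
  show "let n = 1 / 2 * sqrt ((\<beta> * lam + \<gamma>)\<^sup>2 - 4 * (\<alpha> * lam + \<delta>));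
            phi_plus = phi k (of_real (t * (m + n)));
            phi_minus = phi k (of_real (t * (m - n)))
        in phi_mat k (of_real t *\<^sub>M G) =
             ((phi_plus - phi_minus) / of_real (2 * n)) *\<^sub>M
               vector [vector [of_real (- m - n), 1],
                       vector [of_real (n\<^sup>2 - m\<^sup>2), of_real (m - n)]]
             + phi_plus *\<^sub>M mat 1"
    if gt: "(\<beta> * lam + \<gamma>)\<^sup>2 > 4 * (\<alpha> * lam + \<delta>)"
  proof -
    define n where "n = 1 / 2 * sqrt ((\<beta> * lam + \<gamma>)\<^sup>2 - 4 * (\<alpha> * lam + \<delta>))"
    have "n > 0" using gt by (simp add: n_def)
    have "n\<^sup>2 = ((\<beta> * lam + \<gamma>)\<^sup>2 - 4 * (\<alpha> * lam + \<delta>)) / 4"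
      using gt by (simp add: n_def power_mult_distrib power_divide)
    then have "\<alpha> * lam + \<delta> = m\<^sup>2 - n\<^sup>2"
      using assms(7) by (simp add: power_mult_distrib power_divide)
    note tG = tG[OF this]
    \<comment> \<open>The eigenvalue gap is 2 t n; its factor t cancels the one in
      \<open>?N m n\<close>, leaving the denominator 2 n.\<close>
    have diff: "of_real (t * (m + n)) - of_real (t * (m - n)) = (of_real t * of_real (2 * n) :: complex)"
      by (simp add: algebra_simps)
    have ne: "(of_real (t * (m + n)) :: complex) \<noteq> of_real (t * (m - n))"
      using \<open>n > 0\<close> assms(5) unfolding of_real_eq_iff by simp
    show ?thesis
      unfolding Let_def n_def[symmetric] tG phi_mat_distinct[OF cayley_hamilton ne] diff
      using \<open>n > 0\<close> assms(5) by (simp add: vec_eq_iff)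
  qed
  assume eq: "(\<beta> * lam + \<gamma>)\<^sup>2 = 4 * (\<alpha> * lam + \<delta>)"
  \<comment> \<open>Vanishing discriminant is the case n = 0: both eigenvalues equal t m, and the
    factor t stays in the matrix.\<close>
  then have "\<alpha> * lam + \<delta> = m\<^sup>2 - 0\<^sup>2"
    using assms(7) by (simp add: power_mult_distrib power_divide)
  note tG = tG[OF this]
  show "phi_mat k (of_real t *\<^sub>M G) =
          deriv (phi k) (of_real (t * m)) *\<^sub>M
            vector [vector [of_real (- t * m), of_real t],
                    vector [of_real (- t * m\<^sup>2), of_real (t * m)]]
          + phi k (of_real (t * m)) *\<^sub>M mat 1"
    unfolding tG using phi_mat_confluent[of "?N m 0" "of_real (t * m)" k] cayley_hamilton[of 0]
    by (simp add: vec_eq_iff forall_2)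
  have "phi 0 = exp" by (simp add: phi_def fun_eq_iff)
  then show "\<forall>z. phi 0 z = exp z \<and> deriv (phi 0) z = exp z"
    by (simp add: DERIV_imp_deriv)
  show "\<forall>j. \<forall>z. z \<noteq> 0 \<longrightarrow>
      deriv (phi (Suc j)) z = (deriv (phi j) z - phi (Suc j) z) / z
      \<and> phi (Suc j) z = (phi j z - phi j 0) / z"
    \<comment> \<open>Read backwards, the two product identities turn each numerator into a multiple
      of z, which cancels; \<open>phi_zero\<close> identifies the constant.\<close>
    by (simp add: deriv_phi_Suc_mult[symmetric] phi_Suc_mult[symmetric] phi_zero)
qed

end
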